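(* Let $(X,d)$ and $(Y,\varrho)$ be metric spaces and let a point $(\bar x,\bar y)\in X\times Y$ be given. Consider a set-valued mapping $F:X\rightrightarrows Y$, with $\bar y\in F(\bar x)$, for which there are positive constants $c$, $r$, and $\alpha$ such that $\alpha c<1$ and that the set $\mathrm{gph}\,F\cap\big(\mathbb{B}[\bar x,r]\times\mathbb{B}[\bar y,r/\alpha]\big)$ is complete. (i) Assume that for every $x\in\mathbb{B}(\bar x,r)$, every $v\in\mathbb{B}(\bar y,r/\alpha)\cap F(x)$, and every $y\in\mathbb{B}(\bar y,cr)$ satisfying $$0<\varrho(v,y)\le\varrho(\bar y,y)-c\max\{d(x,\bar x),\alpha\varrho(v,\bar y)\}$$ there is a pair $(x',v')\in\mathrm{gph}\,F$ such that $$\varrho(v',y)<\varrho(v,y)-c\max\{d(x,x'),\alpha\varrho(v,v')\}.$$ Then $F(\mathbb{B}(\bar x,t))\supset\mathbb{B}(\bar y,ct)$ for every $t\in(0,r)$. (ii) Assume that $F\big(\mathbb{B}(\bar x,t)\big)\supset\mathbb{B}(\bar y,ct)$ for every $t\in(0,r)$. Then for every $c'\in(0,c)$, every $x\in\mathbb{B}(\bar x,r)$, every $v\in\mathbb{B}(\bar y,r/\alpha)\cap F(x)$, and every $y\in\mathbb{B}(\bar y,c'r)$ satisfying $$0<\varrho(\bar y,y)\le\varrho(v,y)-c'\max\{d(x,\bar x),\alpha\varrho(v,\bar y)\}$$ there is a pair $(x',v')\in\mathrm{gph}\,F$ such that $$\varrho(v',y)<\varrho(v,y)-c'\max\{d(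x,x'),\alpha\varrho(v,v')\}.$$
   Context: $\mathbb{B}(u,r)$ and $\mathbb{B}[u,r]$ denote the open and closed balls with centre $u$ and radius $r>0$. $F:X\rightrightarrows Y$ is a set-valued mapping (values may be empty), $\mathrm{gph}\,F=\{(x,y):y\in F(x)\}$, $F(C)=\bigcup_{x\in C}F(x)$. $X\times Y$ is equipped with the product (box) topology, metrized e.g. by the maximum metric; completeness of a subset of $X\times Y$ is with respect to it. *)

theory Defs
  imports "HOL-Analysis.Analysis"
begin

definition gph :: "('a \<Rightarrow> 'b set) \<Rightarrow> ('a \<times> 'b) set"
  where "gph F = {(x, y). y \<in> F x}"

definition set_valued_image :: "('a \<Rightarrow> 'b set) \<Rightarrow> 'a set \<Rightarrow> 'b set"
  where "set_valued_image F C = (\<Union>x\<in>C. F x)"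

text \<open>
  The library metric on a product type is
  \<open>sqrt ((dist x x')\<^sup>2 + (dist y y')\<^sup>2)\<close>, not the maximum metric. The two are uniformly
  equivalent; the lemma below confirms that \<^const>\<open>complete\<close> on a product type is
  completeness with respect to the maximum metric.
\<close>

lemma complete_prod_iff_max_metric:
  fixes S :: "('a::metric_space \<times> 'b::metric_space) set"
  defines "dmax \<equiv> \<lambda>p q :: 'a \<times> 'b. max (dist (fst p) (fst q)) (dist (snd p) (snd q))"
  shows "complete S \<longleftrightarrow>
    (\<forall>z :: nat \<Rightarrow> _. (\<forall>n. z n \<in> S) \<and> (\<forall>e>0. \<exists>N. \<forall>m\<ge>N. \<forall>n\<ge>N. dmax (z m) (z n) < e)
      \<longrightarrow> (\<exists>l\<in>S. \<forall>e>0. \<exists>N. \<forall>n\<ge>N. dmax (z n) l < e))"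
proof -
  have le: "dmax p q \<le> dist p q" for p q
    unfolding dmax_def by (simp add: dist_fst_le dist_snd_le)
  have ge: "dist p q \<le> 2 * dmax p q" for p q
  proof -
    have "dist p q \<le> dist (fst p) (fst q) + dist (snd p) (snd q)"
      unfolding dist_prod_def by (rule sqrt_sum_squares_le_sum) auto
    then show ?thesis unfolding dmax_def by linarith
  qed
  have C: "Cauchy z \<longleftrightarrow> (\<forall>e>0. \<exists>N. \<forall>m\<ge>N. \<forall>n\<ge>N. dmax (z m) (z n) < e)" for z :: "nat \<Rightarrow> _"
  proof
    assume "Cauchy z"
    then show "\<forall>e>0. \<exists>N. \<forall>m\<ge>N. \<forall>n\<ge>N. dmax (z m) (z n) < e"
      unfolding Cauchy_def by (meson le le_less_trans)
  next
    assume *: "\<forall>e>0. \<exists>N. \<forall>m\<ge>N. \<forall>n\<ge>N. dmax (z m) (z n) < e"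
    show "Cauchy z"
    proof (rule metric_CauchyI)
      fix e :: real assume "e > 0"
      then obtain N where N: "\<forall>m\<ge>N. \<forall>n\<ge>N. dmax (z m) (z n) < e / 2"
        using *[rule_format, of "e / 2"] by auto
      have "dist (z m) (z n) < e" if "m \<ge> N" "n \<ge> N" for m n
        using N[rule_format, OF that] ge[of "z m" "z n"] by linarith
      then show "\<exists>M. \<forall>m\<ge>M. \<forall>n\<ge>M. dist (z m) (z n) < e" by blast
    qed
  qed
  have L: "z \<longlonglongrightarrow> l \<longleftrightarrow> (\<forall>e>0. \<exists>N. \<forall>n\<ge>N. dmax (z n) l < e)" for z :: "nat \<Rightarrow> _" and l
  proof
    assume "z \<longlonglongrightarrow> l"
    then show "\<forall>e>0. \<exists>N. \<forall>n\<ge>N. dmax (z n) l < e"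
      unfolding lim_sequentially by (meson le le_less_trans)
  next
    assume *: "\<forall>e>0. \<exists>N. \<forall>n\<ge>N. dmax (z n) l < e"
    show "z \<longlonglongrightarrow> l"
    proof (rule metric_LIMSEQ_I)
      fix e :: real assume "e > 0"
      then obtain N where N: "\<forall>n\<ge>N. dmax (z n) l < e / 2"
        using *[rule_format, of "e / 2"] by auto
      have "dist (z n) l < e" if "n \<ge> N" for n
        using N[rule_format, OF that] ge[of "z n" l] by linarith
      then show "\<exists>M. \<forall>n\<ge>M. dist (z n) l < e" by blast
    qed
  qed
  show ?thesis unfolding complete_def C L by (rule refl)
qed

end

theory Submission
  imports Defs
begin

text \<open>
  Both parts compare the decrease of the residual \<open>v \<mapsto> dist v y\<close> along the graph of \<open>F\<close> with the
  distance travelled, measured by the weighted maximum metric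
  \<open>max (dist x x') (\<alpha> * dist v v')\<close>.

  For the openness in (i), Ekeland's variational principle is applied to the residual on the
  complete part of the graph, starting from \<open>(xbar, ybar)\<close>. It produces a point \<open>(x, v)\<close> that is
  reached by paying at most the initial residual \<open>dist ybar y < c * t\<close>, hence lies within weighted
  distance \<open>t\<close> of the start, and from which no move within that part lowers the residual at rate
  \<open>c\<close>. If
  \<open>v \<noteq> y\<close>, the hypothesis supplies such a move; by the triangle inequality this move is still paid
  for by the initial residual, so it ends inside the complete part of the graph, a contradiction.
  Hence \<open>y = v \<in> F x\<close>.

  For the converse (ii), the residual can be removed in a single move. The openness property with
  radius \<open>t = dist ybar y / c'\<close> gives \<open>x'\<close> near \<open>xbar\<close> with \<open>y \<in> F x'\<close>, and \<open>(x', y)\<close> is the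
  required pair: the condition on \<open>y\<close> bounds the step from \<open>x\<close> through \<open>xbar\<close> to \<open>x'\<close>, while
  \<open>\<alpha> * c < 1\<close> bounds the step from \<open>v\<close> to \<open>y\<close>. The gap \<open>c' < c\<close> is what places \<open>y\<close> strictly
  inside the ball of radius \<open>c * t\<close>.
\<close>

section \<open>Ekeland's variational principle\<close>

text \<open>
  Write \<open>T p\<close> for the set of points \<open>q \<in> S\<close> with \<open>\<phi> q + D p q \<le> \<phi> p\<close>. The triangle inequality makes
  this a transitive relation, so \<open>T q \<subseteq> T p\<close> for \<open>q \<in> T p\<close>. Choosing each \<open>p (Suc n) \<in> T (p n)\<close> to be
  nearly minimal for \<open>\<phi>\<close> on \<open>T (p n)\<close> forces the diameters of the sets \<open>T (p n)\<close> to shrink to zero, and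
  their common point is the one sought.

  Allowing a cost \<open>D\<close> different from the metric makes the principle applicable to weighted
  metrics on a product. Closedness of the sets \<open>T p\<close> holds in particular when \<open>\<phi>\<close> is lower
  semicontinuous and \<open>D p\<close> is continuous.
\<close>

lemma ekeland_variational_principle:
  fixes S :: "'a::metric_space set" and \<phi> :: "'a \<Rightarrow> real" and D :: "'a \<Rightarrow> 'a \<Rightarrow> real"
  assumes "complete S" and "p0 \<in> S"
    and bdd: "\<And>p. p \<in> S \<Longrightarrow> B \<le> \<phi> p"
    and D_refl: "\<And>p. D p p = 0"
    and D_triangle: "\<And>p q s. D p s \<le> D p q + D q s"
    and dist_le_D: "\<And>p q. dist p q \<le> K * D p q" and "K > 0"
    and closed_T: "\<And>p. p \<in> S \<Longrightarrow> closed {q \<in> S. \<phi> q + D p q \<le> \<phi> p}"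
  obtains l where "l \<in> S" and "\<phi> l + D p0 l \<le> \<phi> p0"
    and "\<And>q. q \<in> S \<Longrightarrow> \<phi> q + D l q \<le> \<phi> l \<Longrightarrow> q = l"
proof -
  define T where "T p = {q \<in> S. \<phi> q + D p q \<le> \<phi> p}" for p
  have T_refl: "p \<in> T p" if "p \<in> S" for p
    using that by (simp add: T_def D_refl)
  have T_trans: "s \<in> T p" if "q \<in> T p" "s \<in> T q" for p q s
    using that D_triangle[of p s q] by (auto simp: T_def)
  have near_min: "\<exists>q \<in> T p. \<forall>s \<in> T p. \<phi> q \<le> \<phi> s + e" if "p \<in> S" "e > 0" for p e
  proof -
    have bb: "bdd_below (\<phi> ` T p)"
      unfolding bdd_below_def T_def using bdd by blast
    have ne: "\<phi> ` T p \<noteq> {}"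
      using T_refl[OF \<open>p \<in> S\<close>] by blast
    obtain q where q: "q \<in> T p" "\<phi> q < Inf (\<phi> ` T p) + e"
      using cInf_lessD[OF ne, of "Inf (\<phi> ` T p) + e"] \<open>e > 0\<close> by auto
    have "\<phi> q \<le> \<phi> s + e" if "s \<in> T p" for s
      using cInf_lower[OF imageI[OF that] bb] q(2) by linarith
    then show ?thesis
      using q(1) by blast
  qed
  have "\<exists>p. p 0 = p0 \<and> (\<forall>n. p n \<in> S \<and>
    (p (Suc n) \<in> T (p n) \<and> (\<forall>s \<in> T (p n). \<phi> (p (Suc n)) \<le> \<phi> s + (1/2) ^ n)))"
  proof -
    have "\<exists>q. q \<in> S \<and> (q \<in> T p \<and> (\<forall>s \<in> T p. \<phi> q \<le> \<phi> s + (1/2) ^ n))"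
      if "p \<in> S" for p n
      using near_min[OF that, of "(1/2) ^ n"] by (auto simp: T_def)
    then show ?thesis
      using dependent_nat_choice[of "\<lambda>n p. p \<in> S \<and> (n = 0 \<longrightarrow> p = p0)"
          "\<lambda>n p q. q \<in> T p \<and> (\<forall>s \<in> T p. \<phi> q \<le> \<phi> s + (1/2) ^ n)"] \<open>p0 \<in> S\<close>
      by auto
  qed
  then obtain p where p0: "p 0 = p0" and pS: "\<And>n. p n \<in> S"
    and p_step: "\<And>n. p (Suc n) \<in> T (p n)"
    and p_min: "\<And>n s. s \<in> T (p n) \<Longrightarrow> \<phi> (p (Suc n)) \<le> \<phi> s + (1/2) ^ n"
    by blast
  have p_mono: "p m \<in> T (p n)" if "n \<le> m" for n m
    using that by (induction m rule: dec_induct) (auto intro: T_refl pS T_trans p_step)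
  have T_small: "dist (p (Suc n)) q \<le> K * (1/2) ^ n" if "q \<in> T (p (Suc n))" for q n
  proof -
    have "D (p (Suc n)) q \<le> \<phi> (p (Suc n)) - \<phi> q"
      using that by (simp add: T_def)
    also have "\<dots> \<le> (1/2) ^ n"
      using p_min[OF T_trans[OF p_step that]] by simp
    finally have "K * D (p (Suc n)) q \<le> K * (1/2) ^ n"
      using \<open>K > 0\<close> by simp
    then show ?thesis
      using dist_le_D[of "p (Suc n)" q] by linarith
  qed
  have small: "(\<lambda>n. K * (1/2) ^ n) \<longlonglongrightarrow> 0"
    by (intro tendsto_mult_right_zero LIMSEQ_realpow_zero) auto
  have "Cauchy p"
    unfolding Cauchy_altdef2
  proof (intro allI impI)
    fix e :: real assume "e > 0"
    then obtain N where N: "K * (1/2) ^ N < e"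
      using order_tendstoD(2)[OF small] by (auto simp: eventually_sequentially)
    have "dist (p n) (p (Suc N)) < e" if "n \<ge> Suc N" for n
      using T_small[OF p_mono[OF that]] N by (simp add: dist_commute)
    then show "\<exists>N. \<forall>n\<ge>N. dist (p n) (p N) < e"
      by blast
  qed
  then obtain l where "l \<in> S" and lim: "p \<longlonglongrightarrow> l"
    using \<open>complete S\<close> pS unfolding complete_def by blast
  have l_in: "l \<in> T (p n)" for n
  proof (rule Lim_in_closed_set[OF _ _ _ lim])
    show "closed (T (p n))"
      unfolding T_def by (rule closed_T[OF pS])
    show "eventually (\<lambda>m. p m \<in> T (p n)) sequentially"
      using p_mono eventually_sequentially by blast
  qed simp
  have unique: "q = l" if "q \<in> T l" for q
  proof -
    have "p \<longlonglongrightarrow> q"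
    proof (rule LIMSEQ_imp_Suc, subst tendsto_dist_iff, rule tendsto_sandwich[OF _ _ _ small])
      show "eventually (\<lambda>n. dist (p (Suc n)) q \<le> K * (1/2) ^ n) sequentially"
        using T_small[OF T_trans[OF l_in that]] by simp
    qed auto
    then show ?thesis
      using lim by (rule LIMSEQ_unique)
  qed
  show ?thesis
    using that[of l] \<open>l \<in> S\<close> l_in[of 0] unique by (auto simp: T_def p0)
qed

section \<open>Slope conditions and linear openness at a point\<close>

text \<open>
  Instance of the variational principle for the residual \<open>dist v y\<close>. The factor \<open>c\<close> belongs to the cost,
  so that cost is directly comparable with residual.
\<close>

lemma ekeland_residual_on_product:
  fixes S :: "('a::metric_space \<times> 'b::metric_space) set"
  assumes "complete S" and "(x0, v0) \<in> S" and "c > 0" and "\<alpha> > 0"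
  obtains x v where "(x, v) \<in> S"
    and "dist v y + c * max (dist x0 x) (\<alpha> * dist v0 v) \<le> dist v0 y"
    and "\<And>x' v'. (x', v') \<in> S \<Longrightarrow>
      dist v' y + c * max (dist x x') (\<alpha> * dist v v') \<le> dist v y \<Longrightarrow> x' = x \<and> v' = v"
proof -
  define D where "D p q = c * max (dist (fst p) (fst q)) (\<alpha> * dist (snd p) (snd q))"
    for p q :: "'a \<times> 'b"
  define \<phi> where "\<phi> p = dist (snd p) y" for p :: "'a \<times> 'b"
  obtain l where "l \<in> S" "\<phi> l + D (x0, v0) l \<le> \<phi> (x0, v0)"
    and "\<And>q. q \<in> S \<Longrightarrow> \<phi> q + D l q \<le> \<phi> l \<Longrightarrow> q = l"
  proof (rule ekeland_variational_principle[of S "(x0, v0)" 0 \<phi> D "1 / c + 1 / (c * \<alpha>)"])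
    show "D p s \<le> D p q + D q s" for p q s
    proof -
      have "\<alpha> * dist (snd p) (snd s) \<le> \<alpha> * dist (snd p) (snd q) + \<alpha> * dist (snd q) (snd s)"
        using dist_triangle[of "snd p" "snd s" "snd q"] \<open>\<alpha> > 0\<close>
        by (simp flip: distrib_left)
      then have "max (dist (fst p) (fst s)) (\<alpha> * dist (snd p) (snd s)) \<le>
        max (dist (fst p) (fst q)) (\<alpha> * dist (snd p) (snd q)) +
        max (dist (fst q) (fst s)) (\<alpha> * dist (snd q) (snd s))"
        using dist_triangle[of "fst p" "fst s" "fst q"] by linarith
      then show ?thesis
        using \<open>c > 0\<close> by (simp add: D_def flip: distrib_left)
    qed
    show "dist p q \<le> (1 / c + 1 / (c * \<alpha>)) * D p q" for p q
    proof -
      define m where "m = max (dist (fst p) (fst q)) (\<alpha> * dist (snd p) (snd q))"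
      have "dist (snd p) (snd q) \<le> m / \<alpha>"
        using \<open>\<alpha> > 0\<close> by (simp add: m_def field_simps)
      moreover have "dist (fst p) (fst q) \<le> m"
        by (simp add: m_def)
      moreover have "dist p q \<le> dist (fst p) (fst q) + dist (snd p) (snd q)"
        unfolding dist_prod_def by (rule sqrt_sum_squares_le_sum) auto
      moreover have "(1 / c + 1 / (c * \<alpha>)) * D p q = m + m / \<alpha>"
        using \<open>c > 0\<close> \<open>\<alpha> > 0\<close> by (simp add: D_def m_def[symmetric] field_simps)
      ultimately show ?thesis
        by linarith
    qed
    show "closed {q \<in> S. \<phi> q + D p q \<le> \<phi> p}" for p
    proof -
      have "closed {q. \<phi> q + D p q \<le> \<phi> p}"
        unfolding \<phi>_def D_def by (intro closed_Collect_le continuous_intros)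
      then have "closed (S \<inter> {q. \<phi> q + D p q \<le> \<phi> p})"
        using complete_imp_closed[OF \<open>complete S\<close>] by (rule closed_Int[rotated])
      then show ?thesis
        by (simp add: Collect_conj_eq)
    qed
  qed (use assms in \<open>auto simp: \<phi>_def D_def add_pos_pos\<close>)
  then show ?thesis
    using that[of "fst l" "snd l"] by (force simp: \<phi>_def D_def)
qed

text \<open>
  The bound \<open>t < r\<close> keeps the Ekeland point, and every point that improves on it, strictly inside the region
  where completeness and the descent hypothesis are available.
\<close>

lemma slope_condition_imp_linear_openness:
  fixes F :: "'a::metric_space \<Rightarrow> 'b::metric_space set"
  assumes "ybar \<in> F xbar" and "c > 0" and "r > 0" and "\<alpha> > 0"
    and compl: "complete (gph F \<inter> (cball xbar r \<times> cball ybar (r / \<alpha>)))"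
    and descent: "\<And>x v y. x \<in> ball xbar r \<Longrightarrow> v \<in> ball ybar (r / \<alpha>) \<inter> F x \<Longrightarrow>
      y \<in> ball ybar (c * r) \<Longrightarrow> 0 < dist v y \<Longrightarrow>
      dist v y \<le> dist ybar y - c * max (dist x xbar) (\<alpha> * dist v ybar) \<Longrightarrow>
      \<exists>(x', v') \<in> gph F. dist v' y < dist v y - c * max (dist x x') (\<alpha> * dist v v')"
    and "t < r"
  shows "ball ybar (c * t) \<subseteq> set_valued_image F (ball xbar t)"
proof
  fix y assume y: "y \<in> ball ybar (c * t)"
  define S where "S = gph F \<inter> (cball xbar r \<times> cball ybar (r / \<alpha>))"
  have "complete S" "(xbar, ybar) \<in> S"
    using compl \<open>ybar \<in> F xbar\<close> \<open>r > 0\<close> \<open>\<alpha> > 0\<close> by (auto simp: S_def gph_def)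
  then obtain x v where "(x, v) \<in> S"
    and start: "dist v y + c * max (dist xbar x) (\<alpha> * dist ybar v) \<le> dist ybar y"
    and minimal: "\<And>x' v'. (x', v') \<in> S \<Longrightarrow>
      dist v' y + c * max (dist x x') (\<alpha> * dist v v') \<le> dist v y \<Longrightarrow> x' = x \<and> v' = v"
    using ekeland_residual_on_product[of S xbar ybar c \<alpha> y] \<open>c > 0\<close> \<open>\<alpha> > 0\<close> by blast
  have "v \<in> F x"
    using \<open>(x, v) \<in> S\<close> by (simp add: S_def gph_def)
  have "c * max (dist xbar x) (\<alpha> * dist ybar v) < c * t"
    using start y zero_le_dist[of v y] unfolding mem_ball by linarith
  then have near: "dist xbar x < t" "\<alpha> * dist ybar v < t"
    using \<open>c > 0\<close> by auto
  have "v = y"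
  proof (rule ccontr)
    assume "v \<noteq> y"
    have "c * t < c * r"
      using \<open>c > 0\<close> \<open>t < r\<close> by simp
    have "x \<in> ball xbar r" "v \<in> ball ybar (r / \<alpha>) \<inter> F x"
      using near \<open>t < r\<close> \<open>v \<in> F x\<close> \<open>\<alpha> > 0\<close> by (auto simp: field_simps)
    moreover have "y \<in> ball ybar (c * r)"
      using y \<open>c * t < c * r\<close> by simp
    moreover have "dist v y \<le> dist ybar y - c * max (dist x xbar) (\<alpha> * dist v ybar)"
      using start by (simp add: dist_commute)
    ultimately obtain x' v' where "(x', v') \<in> gph F"
      and less: "dist v' y < dist v y - c * max (dist x x') (\<alpha> * dist v v')"
      using descent[of x v y] \<open>v \<noteq> y\<close> by auto
    \<comment> \<open>The residuals telescope: the two moves together cost at most \<open>dist ybar y < c * r\<close>.\<close>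
    have "c * (max (dist xbar x) (\<alpha> * dist ybar v) + max (dist x x') (\<alpha> * dist v v')) < c * r"
      using less start y \<open>c * t < c * r\<close> zero_le_dist[of v' y]
      unfolding mem_ball distrib_left by linarith
    then have total: "max (dist xbar x) (\<alpha> * dist ybar v) + max (dist x x') (\<alpha> * dist v v') < r"
      using \<open>c > 0\<close> by simp
    have "dist xbar x' \<le> r"
      using total dist_triangle[of xbar x' x] by linarith
    moreover have "\<alpha> * dist ybar v' \<le> \<alpha> * dist ybar v + \<alpha> * dist v v'"
      using dist_triangle[of ybar v' v] \<open>\<alpha> > 0\<close> by (simp flip: distrib_left)
    then have "\<alpha> * dist ybar v' \<le> r"
      using total by linarith
    ultimately have "(x', v') \<in> S"
      using \<open>(x', v') \<in> gph F\<close> \<open>\<alpha> > 0\<close> by (simp add: S_def field_simps)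
    then have "x' = x \<and> v' = v"
      using minimal less by simp
    then show False
      using less by simp
  qed
  then show "y \<in> set_valued_image F (ball xbar t)"
    using \<open>v \<in> F x\<close> near by (auto simp: set_valued_image_def)
qed

lemma linear_openness_imp_slope_condition:
  fixes F :: "'a::metric_space \<Rightarrow> 'b::metric_space set"
  assumes "\<alpha> > 0" and "\<alpha> * c < 1" and "0 < c'" and "c' < c"
    and opn: "\<And>t. 0 < t \<Longrightarrow> t < r \<Longrightarrow> ball ybar (c * t) \<subseteq> set_valued_image F (ball xbar t)"
    and y: "y \<in> ball ybar (c' * r)" and pos: "0 < dist ybar y"
    and le: "dist ybar y \<le> dist v y - c' * max (dist x xbar) (\<alpha> * dist v ybar)"
  shows "\<exists>(x', v') \<in> gph F. dist v' y < dist v y - c' * max (dist x x') (\<alpha> * dist v v')"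
proof -
  define t where "t = dist ybar y / c'"
  have ct: "c' * t = dist ybar y"
    using \<open>0 < c'\<close> by (simp add: t_def)
  have "0 < t" "t < r"
    using pos y \<open>0 < c'\<close> by (auto simp: t_def field_simps)
  moreover have "y \<in> ball ybar (c * t)"
    using \<open>c' < c\<close> \<open>0 < t\<close> by (simp flip: ct)
  ultimately obtain x' where x': "dist xbar x' < t" "y \<in> F x'"
    using opn[of t] by (auto simp: set_valued_image_def)
  have "c' * dist x x' < c' * (dist x xbar + t)"
    using dist_triangle[of x x' xbar] x'(1) \<open>0 < c'\<close> by simp
  also have "\<dots> = c' * dist x xbar + dist ybar y"
    by (simp add: distrib_left ct)
  also have "\<dots> \<le> c' * max (dist x xbar) (\<alpha> * dist v ybar) + dist ybar y"
    using \<open>0 < c'\<close> by simp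
  also have "\<dots> \<le> dist v y"
    using le by simp
  finally have step_x: "c' * dist x x' < dist v y" .
  have "0 \<le> c' * dist x xbar"
    using \<open>0 < c'\<close> by simp
  also have "\<dots> \<le> c' * max (dist x xbar) (\<alpha> * dist v ybar)"
    using \<open>0 < c'\<close> by simp
  finally have "0 < dist v y"
    using le pos by linarith
  moreover have "\<alpha> * c' < 1"
    using mult_strict_left_mono[OF \<open>c' < c\<close> \<open>\<alpha> > 0\<close>] \<open>\<alpha> * c < 1\<close> by linarith
  ultimately have step_v: "c' * (\<alpha> * dist v y) < dist v y"
    using mult_strict_right_mono[of "\<alpha> * c'" 1 "dist v y"] by (simp add: mult_ac)
  have "c' * max (dist x x') (\<alpha> * dist v y) < dist v y"
    using step_x step_v by (simp add: max_def)
  then show ?thesis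
    using x'(2) by (intro bexI[of _ "(x', y)"]) (auto simp: gph_def)
qed

theorem proposition4p2:
  fixes F :: "'a::metric_space \<Rightarrow> 'b::metric_space set"
    and xbar :: 'a and ybar :: 'b and c r \<alpha> :: real
  assumes "ybar \<in> F xbar"
    and "c > 0" and "r > 0" and "\<alpha> > 0" and "\<alpha> * c < 1"
    and "complete (gph F \<inter> (cball xbar r \<times> cball ybar (r / \<alpha>)))"
  shows
    "((\<forall>x \<in> ball xbar r. \<forall>v \<in> ball ybar (r / \<alpha>) \<inter> F x. \<forall>y \<in> ball ybar (c * r).
         0 < dist v y \<and>
         dist v y \<le> dist ybar y - c * max (dist x xbar) (\<alpha> * dist v ybar) \<longrightarrow>
         (\<exists>(x', v') \<in> gph F.
            dist v' y < dist v y - c * max (dist x x') (\<alpha> * dist v v')))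
      \<longrightarrow> (\<forall>t \<in> {0<..<r}. ball ybar (c * t) \<subseteq> set_valued_image F (ball xbar t)))
     \<and>
     ((\<forall>t \<in> {0<..<r}. ball ybar (c * t) \<subseteq> set_valued_image F (ball xbar t))
      \<longrightarrow> (\<forall>c' \<in> {0<..<c}. \<forall>x \<in> ball xbar r. \<forall>v \<in> ball ybar (r / \<alpha>) \<inter> F x.
           \<forall>y \<in> ball ybar (c' * r).
             0 < dist ybar y \<and>
             dist ybar y \<le> dist v y - c' * max (dist x xbar) (\<alpha> * dist v ybar) \<longrightarrow>
             (\<exists>(x', v') \<in> gph F.
                dist v' y < dist v y - c' * max (dist x x') (\<alpha> * dist v v'))))"
proof (intro conjI impI ballI; (elim conjE)?)
  fix t
  assume "\<forall>x \<in> ball xbar r. \<forall>v \<in> ball ybar (r / \<alpha>) \<inter> F x. \<forall>y \<in> ball ybar (c * r).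
    0 < dist v y \<and> dist v y \<le> dist ybar y - c * max (dist x xbar) (\<alpha> * dist v ybar) \<longrightarrow>
    (\<exists>(x', v') \<in> gph F. dist v' y < dist v y - c * max (dist x x') (\<alpha> * dist v v'))"
    and "t \<in> {0<..<r}"
  then show "ball ybar (c * t) \<subseteq> set_valued_image F (ball xbar t)"
    using assms by (intro slope_condition_imp_linear_openness[where r = r and \<alpha> = \<alpha>]) auto
next
  fix c' x v y
  assume "\<forall>t \<in> {0<..<r}. ball ybar (c * t) \<subseteq> set_valued_image F (ball xbar t)"
    and "c' \<in> {0<..<c}" and "y \<in> ball ybar (c' * r)" and "0 < dist ybar y"
    and "dist ybar y \<le> dist v y - c' * max (dist x xbar) (\<alpha> * dist v ybar)"
  then show "\<exists>(x', v') \<in> gph F. dist v' y < dist v y - c' * max (dist x x') (\<alpha> * dist v v')"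
    using assms
    by (intro linear_openness_imp_slope_condition[where c = c and r = r
          and ybar = ybar and xbar = xbar]) auto
qed

end
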